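(* Let $\beta\in(0,1]$, $a,b\in\mathbb{R}$ with $0\le a<b$, and $M>0$. Let $f:[a,b]\to[0,M]$ and $g:[a,b]\to[0,M]$ be $\beta$-fractional integrable functions on $[a,b]$. If $f$ is nonnegative and nonincreasing, then $$M\int_{b-l}^{b}f(t)\,d_\beta t\le\int_a^b f(t)g(t)\,d_\beta t\le M\int_a^{a+l}f(t)\,d_\beta t ,$$ where $$l:=\frac{\beta(b-a)}{M\left[\left(b+\frac{1}{\Gamma(\beta)}\right)^{\beta}-\left(a+\frac{1}{\Gamma(\beta)}\right)^{\beta}\right]}\int_a^b g(t)\,d_\beta t .$$
   Context: For $\beta\in(0,1]$ and $0\le a<b$, the $\beta$-integral is $\int_a^b h(t)\,d_\beta t:=\int_a^b\left(t+\frac{1}{\Gamma(\beta)}\right)^{\beta-1}h(t)\,dt$, and $h$ is $\beta$-fractional integrable on $[a,b]$ if this integral exists and is finite. *)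

theory Defs
  imports "HOL-Analysis.Analysis"
begin

text \<open>
  The integrals are Lebesgue integrals over the closed interval. For the relevant
  parameters (\<open>0 < \<beta>\<close>, \<open>0 \<le> t\<close>) the base of the power is positive, so \<^const>\<open>powr\<close> is the
  usual real power. The integral is not oriented: it is meant for \<open>a \<le> b\<close> only.
\<close>

definition beta_weight :: "real \<Rightarrow> real \<Rightarrow> real" where
  "beta_weight \<beta> t = (t + 1 / Gamma \<beta>) powr (\<beta> - 1)"

definition beta_integrable :: "real \<Rightarrow> real \<Rightarrow> real \<Rightarrow> (real \<Rightarrow> real) \<Rightarrow> bool" where
  "beta_integrable \<beta> a b h \<longleftrightarrow>
     set_integrable lebesgue {a..b} (\<lambda>t. beta_weight \<beta> t * h t)"

definition beta_integral :: "real \<Rightarrow> real \<Rightarrow> real \<Rightarrow> (real \<Rightarrow> real) \<Rightarrow> real" where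
  "beta_integral \<beta> a b h =
     set_lebesgue_integral lebesgue {a..b} (\<lambda>t. beta_weight \<beta> t * h t)"

end

theory Submission
  imports Defs
begin

text \<open>
  For \<open>c \<in> [a, b]\<close>, monotonicity of \<open>f\<close> makes \<open>(f t - f c) * (M * indicator {a..c} t - g t)\<close>
  nonnegative; integrating against the weight \<open>w\<close> reduces the upper bound to
  \<open>\<integral> w * g \<le> M * \<integral>\<^bsub>[a, c]\<^esub> w\<close>, and symmetrically for the lower bound with \<open>[c, b]\<close>.
  For \<open>c = a + l\<close> and \<open>c = b - l\<close> these two conditions follow from the concavity of
  \<open>x \<mapsto> (x + 1 / \<Gamma>(\<beta>)) powr \<beta>\<close>, a primitive of \<open>\<beta> * w\<close>: the average of the decreasing
  weight over an initial (final) segment is at least (at most) its average over \<open>[a, b]\<close>.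
\<close>

text \<open>
  The level \<open>k\<close> may be negative, so that the lemma also applies to \<open>- f\<close>, which yields
  the reversed inequality.
\<close>

lemma bathtub_inequality:
  fixes w f g :: "'a \<Rightarrow> real"
  assumes T: "T \<in> sets N" "T \<subseteq> S"
    and w: "\<And>t. t \<in> S \<Longrightarrow> 0 \<le> w t"
    and g: "\<And>t. t \<in> S \<Longrightarrow> 0 \<le> g t" "\<And>t. t \<in> S \<Longrightarrow> g t \<le> M"
    and f: "\<And>t. t \<in> T \<Longrightarrow> k \<le> f t" "\<And>t. t \<in> S - T \<Longrightarrow> f t \<le> k"
    and iw: "set_integrable N S w"
    and iwf: "set_integrable N S (\<lambda>t. w t * f t)"
    and iwg: "set_integrable N S (\<lambda>t. w t * g t)"
    and iwfg: "set_integrable N S (\<lambda>t. w t * (f t * g t))"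
    and mass: "k * (LINT t:S|N. w t * g t) \<le> k * (M * (LINT t:T|N. w t))"
  shows "(LINT t:S|N. w t * (f t * g t)) \<le> M * (LINT t:T|N. w t * f t)"
proof -
  \<comment> \<open>Chosen so that \<open>F\<close> integrates, term by term, to the difference of
    the two sides of the claim minus the gap in \<open>mass\<close>. That gap is nonnegative, so it
    suffices that \<open>F\<close> is nonnegative.\<close>
  define F where "F t = M * (indicator T t * (w t * f t)) - indicator S t * (w t * (f t * g t))
    - k * (M * (indicator T t * w t) - indicator S t * (w t * g t))" for t
  have iT: "set_integrable N T w" "set_integrable N T (\<lambda>t. w t * f t)"
    using set_integrable_subset[OF iw T] set_integrable_subset[OF iwf T] .
  note I = iT iwg iwfg
  have "0 \<le> F t" for t
  proof -
    \<comment> \<open>In this factored form the last two factors never have opposite signs: on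
      \<open>T\<close> both are \<ge> 0, on \<open>S - T\<close> both are \<le> 0.\<close>
    have *: "F t = indicator S t * (w t * ((f t - k) * (M * indicator T t - g t)))"
      using T(2) by (auto simp: F_def indicator_def algebra_simps)
    have "0 \<le> (f t - k) * (M * indicator T t - g t)" if "t \<in> S"
      using f[of t] g[of t] that
      by (cases "t \<in> T") (auto intro: mult_nonneg_nonneg simp: mult_nonpos_nonneg)
    then show ?thesis
      unfolding * using w[of t] by (cases "t \<in> S") auto
  qed
  then have "0 \<le> (LINT t|N. F t)"
    by (rule Bochner_Integration.integral_nonneg)
  also have "\<dots> = M * (LINT t:T|N. w t * f t) - (LINT t:S|N. w t * (f t * g t))
      - k * (M * (LINT t:T|N. w t) - (LINT t:S|N. w t * g t))"
    using I unfolding F_def set_integrable_def set_lebesgue_integral_def by simp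
  finally show ?thesis
    using mass by (simp add: algebra_simps)
qed

text \<open>The product is dominated by \<open>M * (w * g)\<close> in absolute value. Measurability
  is known only for the weighted functions on \<open>S\<close>, so it is recovered by writing the
  product as \<open>(w * f) * (w * g) / w\<close>, where \<open>w\<close> does not vanish on
  \<open>S\<close>.\<close>

lemma set_integrable_mult_bounded:
  fixes w f g :: "'a \<Rightarrow> real"
  assumes wf: "set_integrable N S (\<lambda>t. w t * f t)"
    and wg: "set_integrable N S (\<lambda>t. w t * g t)"
    and w: "w \<in> borel_measurable N" "\<And>t. t \<in> S \<Longrightarrow> w t \<noteq> 0"
    and f: "\<And>t. t \<in> S \<Longrightarrow> \<bar>f t\<bar> \<le> M"
  shows "set_integrable N S (\<lambda>t. w t * (f t * g t))"
  unfolding set_integrable_def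
proof (rule Bochner_Integration.integrable_bound)
  let ?G = "\<lambda>t. indicator S t *\<^sub>R (w t * g t)"
  show "integrable N (\<lambda>t. M * ?G t)"
    using wg unfolding set_integrable_def by (intro integrable_mult_right)
  have "(\<lambda>t. indicator S t *\<^sub>R (w t * f t) * ?G t / w t) \<in> borel_measurable N"
    using wf wg w(1) unfolding set_integrable_def
    by (intro borel_measurable_divide borel_measurable_times) auto
  also have "(\<lambda>t. indicator S t *\<^sub>R (w t * f t) * ?G t / w t)
      = (\<lambda>t. indicator S t *\<^sub>R (w t * (f t * g t)))"
    using w(2) by (auto simp: indicator_def fun_eq_iff)
  finally show "(\<lambda>t. indicator S t *\<^sub>R (w t * (f t * g t))) \<in> borel_measurable N" .
  have "\<bar>f t\<bar> * \<bar>w t * g t\<bar> \<le> \<bar>M\<bar> * \<bar>w t * g t\<bar>" if "t \<in> S" for t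
    using f[OF that] by (intro mult_right_mono) auto
  then show "AE t in N. norm (indicator S t *\<^sub>R (w t * (f t * g t))) \<le> norm (M * ?G t)"
    by (intro AE_I2) (auto simp: indicator_def abs_mult mult_ac)
qed

lemma concave_on_powr:
  assumes "0 \<le> p" "p \<le> 1"
  shows "concave_on {0<..} (\<lambda>x::real. x powr p)"
proof (rule f''_le0_imp_concave)
  show "((\<lambda>x. x powr p) has_real_derivative p * x powr (p - 1)) (at x)"
    if "x \<in> {0<..}" for x
    using that by (auto intro!: derivative_eq_intros)
  show "((\<lambda>x. p * x powr (p - 1)) has_real_derivative p * ((p - 1) * x powr (p - 1 - 1))) (at x)"
    if "x \<in> {0<..}" for x
    using that by (auto intro!: derivative_eq_intros)
  show "p * ((p - 1) * x powr (p - 1 - 1)) \<le> 0" if "x \<in> {0<..}" for x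
    using assms by (intro mult_nonneg_nonpos mult_nonpos_nonneg) auto
qed auto

lemma
  assumes "0 < \<beta>" "0 \<le> a" "a \<le> b"
  shows set_integrable_beta_weight: "set_integrable lebesgue {a..b} (beta_weight \<beta>)"
    and set_integral_beta_weight: "(LINT t:{a..b}|lebesgue. beta_weight \<beta> t)
      = ((b + 1 / Gamma \<beta>) powr \<beta> - (a + 1 / Gamma \<beta>) powr \<beta>) / \<beta>"
proof -
  have pos: "0 < t + 1 / Gamma \<beta>" if "t \<in> {a..b}" for t
    using that assms Gamma_real_pos[of \<beta>] by (intro add_nonneg_pos) auto
  have "continuous_on {a..b} (beta_weight \<beta>)"
    unfolding beta_weight_def
    by (intro continuous_intros) (use pos in fastforce)
  then show int: "set_integrable lebesgue {a..b} (beta_weight \<beta>)"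
    by (rule absolutely_integrable_continuous_real)
  \<comment> \<open>The fundamental theorem of calculus yields a gauge integral; it agrees with the
    Lebesgue integral by the absolute integrability in \<open>int\<close>.\<close>
  have "((\<lambda>t. (t + 1 / Gamma \<beta>) powr \<beta> / \<beta>) has_real_derivative beta_weight \<beta> t)
      (at t within {a..b})" if "t \<in> {a..b}" for t
    using pos[OF that] assms(1) unfolding beta_weight_def
    by (auto intro!: derivative_eq_intros)
  then have "(beta_weight \<beta> has_integral
      (b + 1 / Gamma \<beta>) powr \<beta> / \<beta> - (a + 1 / Gamma \<beta>) powr \<beta> / \<beta>) {a..b}"
    using assms(3) by (intro fundamental_theorem_of_calculus)
      (auto simp: has_real_derivative_iff_has_vector_derivative)
  then show "(LINT t:{a..b}|lebesgue. beta_weight \<beta> t)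
      = ((b + 1 / Gamma \<beta>) powr \<beta> - (a + 1 / Gamma \<beta>) powr \<beta>) / \<beta>"
    using set_lebesgue_integral_eq_integral(2)[OF int]
    by (simp add: integral_unique diff_divide_distrib)
qed

theorem theorem3:
  fixes \<beta> a b M l :: real and f g :: "real \<Rightarrow> real"
  assumes "0 < \<beta>" and "\<beta> \<le> 1"
    and "0 \<le> a" and "a < b"
    and "0 < M"
    and "f \<in> {a..b} \<rightarrow> {0..M}"
    and "g \<in> {a..b} \<rightarrow> {0..M}"
    and "beta_integrable \<beta> a b f"
    and "beta_integrable \<beta> a b g"
    and "\<forall>t\<in>{a..b}. 0 \<le> f t"
    and "antimono_on {a..b} f"
    and "l = \<beta> * (b - a)
             / (M * ((b + 1 / Gamma \<beta>) powr \<beta> - (a + 1 / Gamma \<beta>) powr \<beta>))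
             * beta_integral \<beta> a b g"
  shows "M * beta_integral \<beta> (b - l) b f \<le> beta_integral \<beta> a b (\<lambda>t. f t * g t)
       \<and> beta_integral \<beta> a b (\<lambda>t. f t * g t) \<le> M * beta_integral \<beta> a (a + l) f"
proof -
  define w where "w = beta_weight \<beta>"
  define P where "P x = (x + 1 / Gamma \<beta>) powr \<beta>" for x
  define G where "G = (LINT t:{a..b}|lebesgue. w t * g t)"
  define s where "s = l / (b - a)"
  have pos: "0 < t + 1 / Gamma \<beta>" if "a \<le> t" for t
    using that assms(1,3) Gamma_real_pos[of \<beta>] by (intro add_nonneg_pos) auto
  have wpos: "0 < w t" if "t \<in> {a..b}" for t
    using pos[of t] that by (simp add: w_def beta_weight_def)
  have f: "\<bar>f t\<bar> \<le> M" if "t \<in> {a..b}" for t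
    using funcset_mem[OF assms(6) that] by simp
  have g: "0 \<le> g t" "g t \<le> M" if "t \<in> {a..b}" for t
    using assms(7) that by auto
  have iw: "set_integrable lebesgue {a..b} w"
    using assms(1,3,4) unfolding w_def by (intro set_integrable_beta_weight) auto
  have iwf: "set_integrable lebesgue {a..b} (\<lambda>t. w t * f t)"
    and iwg: "set_integrable lebesgue {a..b} (\<lambda>t. w t * g t)"
    using assms(8,9) unfolding beta_integrable_def w_def .
  have "w \<in> borel_measurable borel"
    unfolding w_def beta_weight_def[abs_def] by measurable
  then have "w \<in> borel_measurable lebesgue"
    by (metis measurable_completion measurable_lborel2)
  then have iwfg: "set_integrable lebesgue {a..b} (\<lambda>t. w t * (f t * g t))"
    using wpos f by (intro set_integrable_mult_bounded[OF iwf iwg, where M = M]) force+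
  have W: "(LINT t:{c..d}|lebesgue. w t) = (P d - P c) / \<beta>" if "a \<le> c" "c \<le> d" for c d
    using that assms(1,3) unfolding w_def P_def by (intro set_integral_beta_weight) auto
  have "P a < P b"
    unfolding P_def using pos[of a] assms(1,4) by (intro powr_less_mono2) auto
  \<comment> \<open>So \<open>s\<close> is the ratio of \<open>G\<close> to \<open>M\<close> times
    the integral of \<open>w\<close> over \<open>[a, b]\<close>. As \<open>g\<close> takes values in
    \<open>[0, M]\<close>, this ratio lies in \<open>[0, 1]\<close>, which keeps
    \<open>a + l\<close> and \<open>b - l\<close> inside \<open>[a, b]\<close>.\<close>
  then have sG: "s * (P b - P a) / \<beta> * M = G"
    using assms(1,4,5,12) unfolding s_def G_def w_def P_def[symmetric] beta_integral_def
    by (simp add: field_simps)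
  have "0 \<le> G"
    unfolding G_def set_lebesgue_integral_def using wpos g
    by (intro Bochner_Integration.integral_nonneg) (auto simp: indicator_def less_imp_le)
  have "G \<le> (LINT t:{a..b}|lebesgue. w t * M)"
    unfolding G_def using iw wpos g
    by (intro set_integral_mono iwg) (auto intro: mult_left_mono less_imp_le)
  also have "\<dots> = (P b - P a) / \<beta> * M"
    using W[of a b] assms(4) by simp
  finally have s: "0 \<le> s" "s \<le> 1"
    using \<open>0 \<le> G\<close> \<open>P a < P b\<close> assms(1,5) unfolding sG[symmetric]
    by (simp_all add: zero_le_mult_iff divide_simps)
  have l: "l = s * (b - a)"
    using assms(4) by (simp add: s_def)
  have l_bounds: "0 \<le> l" "l \<le> b - a"
    using s assms(4) mult_right_mono[of s 1 "b - a"] by (auto simp: l)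
  \<comment> \<open>Concavity of the power is applied at the endpoints shifted by
    \<open>1 / Gamma \<beta>\<close>, which are positive.\<close>
  have conc: "(1 - u) * P a + u * P b \<le> P (a + u * (b - a))" if "0 \<le> u" "u \<le> 1" for u
    using concave_onD[OF concave_on_powr[of \<beta>], of u "a + 1 / Gamma \<beta>" "b + 1 / Gamma \<beta>"]
      that assms(1,2,4) pos[of a] pos[of b]
    by (simp add: P_def algebra_simps diff_divide_distrib)
  have mass_upper: "G \<le> M * (LINT t:{a..a + l}|lebesgue. w t)"
  proof -
    have "s * (P b - P a) \<le> P (a + l) - P a"
      using conc[OF s] by (simp add: l algebra_simps)
    then have "s * (P b - P a) / \<beta> * M \<le> (P (a + l) - P a) / \<beta> * M"
      using assms(1,5) by (intro mult_right_mono divide_right_mono) auto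
    then show ?thesis
      using sG W[of a "a + l"] l_bounds by (simp add: mult.commute)
  qed
  have mass_lower: "M * (LINT t:{b - l..b}|lebesgue. w t) \<le> G"
  proof -
    \<comment> \<open>The final segment has relative length \<open>s\<close>, so its left end is the
      convex combination with parameter \<open>1 - s\<close>.\<close>
    have eq: "a + (1 - s) * (b - a) = b - l"
      by (simp add: l algebra_simps)
    have "P b - P (b - l) \<le> s * (P b - P a)"
      using conc[of "1 - s", unfolded eq] s by (simp add: algebra_simps)
    then have "(P b - P (b - l)) / \<beta> * M \<le> s * (P b - P a) / \<beta> * M"
      using assms(1,5) by (intro mult_right_mono divide_right_mono) auto
    then show ?thesis
      using sG W[of "b - l" b] l_bounds by (simp add: mult.commute)
  qed
  have mono: "f y \<le> f x" if "a \<le> x" "x \<le> y" "y \<le> b" for x y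
    using monotone_onD[OF assms(11), of x y] that by simp
  have "(LINT t:{a..b}|lebesgue. w t * (f t * g t)) \<le> M * (LINT t:{a..a + l}|lebesgue. w t * f t)"
  \<comment> \<open>The level is the value of \<open>f\<close> at the cut. It is nonnegative, so
    multiplying \<open>mass_upper\<close> by it keeps the direction.\<close>
  proof (rule bathtub_inequality[where k = "f (a + l)"])
    show "f (a + l) * (LINT t:{a..b}|lebesgue. w t * g t)
        \<le> f (a + l) * (M * (LINT t:{a..a + l}|lebesgue. w t))"
      using mass_upper assms(10) l_bounds unfolding G_def by (intro mult_left_mono) auto
  qed (use l_bounds wpos g mono iw iwf iwg iwfg in \<open>auto simp: less_imp_le\<close>)
  moreover have "(LINT t:{a..b}|lebesgue. w t * (- f t * g t))
      \<le> M * (LINT t:{b - l..b}|lebesgue. w t * - f t)"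
  \<comment> \<open>Since \<open>- f\<close> is nondecreasing, it exceeds its value at the cut on
    the final segment. This level is nonpositive, so it turns \<open>mass_lower\<close> into the
    required mass condition.\<close>
  proof (rule bathtub_inequality[where k = "- f (b - l)"])
    show "- f (b - l) * (LINT t:{a..b}|lebesgue. w t * g t)
        \<le> - f (b - l) * (M * (LINT t:{b - l..b}|lebesgue. w t))"
      using mass_lower assms(10) l_bounds unfolding G_def by (intro mult_left_mono_neg) auto
  qed (use l_bounds wpos g mono iw iwf iwg iwfg in \<open>auto simp: less_imp_le set_integrable_def\<close>)
  ultimately show ?thesis
    unfolding beta_integral_def w_def[symmetric] by (simp add: set_lebesgue_integral_def)
qed

end
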